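(* Let $m > 1$ be an integer and $a$ an integer such that $\gcd(a,m)$ is square-free, and let $\gamma \in \{\pi/4, 3\pi/4\}$. Then the congruence class of $a$ modulo $m$ contains infinitely many square-free $\gamma$-congruent numbers.
   Context: For $\theta \in \{\pi/4,3\pi/4\}$, a positive integer $n$ is $\theta$-congruent if there exist positive rationals $a,b,c$ such that the triangle with sides $a$, $b\sqrt2$, $c$ has angle $\theta$ opposite $c$ and area $n$; equivalently $ab = 2n$ and $c^2 = a^2+2b^2-2ab$ (for $\theta = \pi/4$), resp. $c^2 = a^2+2b^2+2ab$ (for $\theta=3\pi/4$). *)

theory Defs
  imports Complex_Main "HOL-Computational_Algebra.Squarefree" "HOL-Number_Theory.Cong"
begin

text \<open>A positive integer n is theta-congruent if there are positive rationals a, b, c such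
  that the triangle with sides a, b*sqrt 2, c has angle theta opposite c and area n.
  Angle theta opposite c (law of cosines) and area (1/2 * a * (b sqrt 2) * sin theta).\<close>
definition theta_congruent :: "real \<Rightarrow> nat \<Rightarrow> bool" where
  "theta_congruent \<theta> n \<longleftrightarrow> n > 0 \<and>
     (\<exists>a b c :: rat. a > 0 \<and> b > 0 \<and> c > 0 \<and>
        (real_of_rat c)\<^sup>2 = (real_of_rat a)\<^sup>2 + (real_of_rat b * sqrt 2)\<^sup>2
            - 2 * real_of_rat a * (real_of_rat b * sqrt 2) * cos \<theta> \<and>
        real n = 1/2 * real_of_rat a * (real_of_rat b * sqrt 2) * sin \<theta>)"

end

theory Submission
  imports Defs "HOL-Library.Infinite_Set"
begin

text \<open>
  Put \<open>e = 1\<close> for the angle \<open>\<pi>/4\<close> and \<open>e = -1\<close> for \<open>3\<pi>/4\<close>. The law of cosines reads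
  \<open>c\<^sup>2 = (a - e b)\<^sup>2 + b\<^sup>2\<close>, so the Pythagorean parametrisation with parameter \<open>u = r M\<^sup>2\<close>, scaled
  by \<open>1/M\<close>, gives a triangle of area \<open>n(r) = r (u\<^sup>2 + 2 e u - 1) = r ((u + e)\<^sup>2 - 2)\<close>, and
  \<open>n(r)\<close> is congruent to \<open>-r\<close> modulo \<open>M\<close>. Take \<open>M\<close> to be a multiple of \<open>m\<close> and of all \<open>p\<^sup>2\<close> with
  \<open>p \<le> z\<close>, and let \<open>r\<close> run through a class modulo \<open>M\<close> that reduces to \<open>-a\<close> modulo \<open>m\<close> and is
  not divisible by any of these \<open>p\<^sup>2\<close>; then no \<open>p\<^sup>2\<close> with \<open>p \<le> z\<close> divides \<open>n(r)\<close>. A prime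
  \<open>p > z\<close> excludes at most three classes modulo \<open>p\<^sup>2\<close>, and among the first \<open>K\<close> terms only primes
  \<open>p = O(K)\<close> matter. Since the number of primes up to \<open>x\<close> is \<open>o(x)\<close>, at least half of the terms,
  up to \<open>O(1)\<close>, survive.
\<close>

section \<open>Counting primes\<close>

lemma prod_primes_dvd:
  fixes n :: nat
  assumes "finite A" and "\<And>p. p \<in> A \<Longrightarrow> prime p" and "\<And>p. p \<in> A \<Longrightarrow> p dvd n"
  shows "\<Prod>A dvd n"
  using assms
proof (induction A rule: finite_induct)
  case (insert p A)
  have "coprime p (\<Prod>A)"
    using insert.hyps insert.prems by (intro prod_coprime_right) (auto intro: primes_coprime)
  then show ?case
    using insert by (simp add: divides_mult)
qed auto

text \<open>A prime in this range divides \<open>fact (2 * n)\<close> but not \<open>fact n\<close>,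
  so it survives in the central binomial coefficient. Distinct primes that divide a number have a
  product that divides it.\<close>

lemma prod_primes_le_binomial:
  "\<Prod>{p::nat. prime p \<and> n < p \<and> p \<le> 2 * n} \<le> (2 * n) choose n"
proof (rule dvd_imp_le[OF prod_primes_dvd])
  fix p assume p: "p \<in> {p. prime p \<and> n < p \<and> p \<le> 2 * n}"
  have "p dvd fact (2 * n)"
    using p by (simp add: prime_dvd_fact_iff)
  also have "fact (2 * n) = fact n * fact n * ((2 * n) choose n)"
    using binomial_fact_lemma[of n "2 * n"] by simp
  finally show "p dvd (2 * n) choose n"
    using p by (simp add: prime_dvd_mult_iff prime_dvd_fact_iff)
qed auto

text \<open>Chebyshev-type bound by halving: primes up to \<open>h\<close> fall to the induction
  hypothesis, those in \<open>(h, 2h]\<close> to the central binomial coefficient. Rounding up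
  allows \<open>h = 2n/3\<close> (at \<open>n = 3\<close>), and a base \<open>C\<close> passes the
  step \<open>(4C)^h <= C^n\<close> there exactly when \<open>C >= 16\<close>.\<close>

lemma primorial_le: "\<Prod>{p::nat. prime p \<and> p \<le> n} \<le> 16 ^ n"
proof (induction n rule: less_induct)
  case (less n)
  consider "n \<le> 1" | "n = 2" | "n \<ge> 3" by linarith
  then show ?case
  proof cases
    case 1
    have none: "{p::nat. prime p \<and> p \<le> n} = {}"
      using 1 by (auto dest: prime_ge_2_nat)
    show ?thesis unfolding none by simp
  next
    case 2
    then have "{p::nat. prime p \<and> p \<le> n} = {2}"
      using prime_ge_2_nat by (auto intro: antisym)
    then show ?thesis using 2 by simp
  next
    case 3
    define h where "h = (n + 1) div 2"
    have h: "h < n" "n \<le> 2 * h" "3 * h \<le> 2 * n"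
      using 3 by (auto simp: h_def)
    let ?A = "{p::nat. prime p \<and> p \<le> h}" and ?B = "{p::nat. prime p \<and> h < p \<and> p \<le> 2 * h}"
    have "\<Prod>{p::nat. prime p \<and> p \<le> n} \<le> \<Prod>(?A \<union> ?B)"
      using h by (intro dvd_imp_le prod_dvd_prod_subset)
                 (auto intro!: prod_pos dest: prime_gt_0_nat)
    also have "\<dots> = \<Prod>?A * \<Prod>?B"
      by (intro prod.union_disjoint) auto
    also have "\<dots> \<le> 16 ^ h * 2 ^ (2 * h)"
      using less.IH[OF h(1)] prod_primes_le_binomial[of h] binomial_le_pow2[of "2 * h" h]
      by (intro mult_mono) linarith+
    also have "\<dots> = 4 ^ (3 * h)"
      by (simp add: power_mult flip: power_mult_distrib)
    also have "\<dots> \<le> 4 ^ (2 * n)"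
      using h by (intro power_increasing) auto
    also have "\<dots> = 16 ^ n"
      by (simp add: power_mult)
    finally show ?thesis .
  qed
qed

text \<open>An explicit form of pi(x) = o(x). Each prime above \<open>16 ^ q\<close> contributes at
  least \<open>16 ^ q\<close> to a product bounded by \<open>16 ^ x\<close>, so there are at most
  \<open>x / q\<close> of them; at most \<open>16 ^ q\<close> primes remain.\<close>

lemma prime_count_le:
  "q * card {p::nat. prime p \<and> p \<le> x} \<le> q * 16 ^ q + x"
proof -
  let ?L = "{p::nat. prime p \<and> p \<le> x \<and> 16 ^ q < p}"
  have "(16::nat) ^ (q * card ?L) = (\<Prod>p\<in>?L. 16 ^ q)"
    by (simp add: power_mult)
  also have "\<dots> \<le> \<Prod>?L"
    by (intro prod_mono) auto
  also have "\<dots> \<le> \<Prod>{p::nat. prime p \<and> p \<le> x}"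
    by (intro dvd_imp_le prod_dvd_prod_subset) (auto intro!: prod_pos dest: prime_gt_0_nat)
  also have "\<dots> \<le> 16 ^ x"
    by (rule primorial_le)
  finally have L: "q * card ?L \<le> x" by simp
  have "card {p::nat. prime p \<and> p \<le> x} \<le> card ({1..16 ^ q} \<union> ?L)"
    by (intro card_mono) (auto dest: prime_gt_0_nat simp: Suc_le_eq)
  also have "\<dots> \<le> 16 ^ q + card ?L"
    by (rule order.trans[OF card_Un_le]) simp
  finally have "q * card {p::nat. prime p \<and> p \<le> x} \<le> q * (16 ^ q + card ?L)"
    by (rule mult_le_mono2)
  then show ?thesis using L by (simp add: distrib_left)
qed

lemma sum_inverse_squares_le:
  assumes "0 < z" and "z \<le> y"
  shows "(\<Sum>n\<in>{z<..y}. 1 / (real n)\<^sup>2) \<le> 1 / real z - 1 / real y"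
  using assms(2)
proof (induction y rule: dec_induct)
  case (step y)
  have "{z<..Suc y} = insert (Suc y) {z<..y}" using step by auto
  moreover have "1 / (real (Suc y))\<^sup>2 \<le> 1 / (real y * real (Suc y))"
    using step.hyps assms(1) by (intro divide_left_mono) (auto simp: power2_eq_square)
  moreover have "1 / (real y * real (Suc y)) = 1 / real y - 1 / real (Suc y)"
    using step.hyps assms(1) by (simp add: field_simps)
  ultimately show ?case using step by simp
qed simp

section \<open>Local conditions\<close>

text \<open>Elements of a single class modulo \<open>d\<close> are determined by their quotients by
  \<open>d\<close>, which lie between 0 and \<open>K div d\<close>.\<close>

lemma card_pairwise_cong_le:
  fixes A :: "nat set"
  assumes "A \<subseteq> {..<K}" and "0 < d" and "\<And>x y. x \<in> A \<Longrightarrow> y \<in> A \<Longrightarrow> [x = y] (mod d)"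
  shows "card A \<le> K div d + 1"
proof -
  have "inj_on (\<lambda>x. x div d) A"
    using assms(3) by (auto intro!: inj_onI simp: cong_def) (metis div_mult_mod_eq)
  moreover have "(\<lambda>x. x div d) ` A \<subseteq> {..K div d}"
    using assms(1) by (auto intro!: div_le_mono)
  ultimately have "card A \<le> card {..K div d}"
    by (metis card_image card_mono finite_atMost)
  then show ?thesis by simp
qed

text \<open>Modulo \<open>p^2\<close>, 2 has at most two square roots. A \<open>p\<close> dividing
  both factors of \<open>(x - y) * (x + y)\<close> would divide \<open>2 * x\<close>, hence
  \<open>x\<close>, hence 2; so all of \<open>p^2\<close> goes into one factor.\<close>

lemma prime_square_dvd_diff_or_sum:
  fixes p x y :: int
  assumes "prime p" and "2 < p" and "p\<^sup>2 dvd x\<^sup>2 - 2" and "p\<^sup>2 dvd y\<^sup>2 - 2"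
  shows "p\<^sup>2 dvd x - y \<or> p\<^sup>2 dvd x + y"
proof -
  have "p\<^sup>2 dvd (x\<^sup>2 - 2) - (y\<^sup>2 - 2)"
    using assms(3,4) by (rule dvd_diff)
  then have dvd: "p\<^sup>2 dvd (x - y) * (x + y)"
    by (simp add: algebra_simps power2_eq_square)
  have not2: "\<not> p dvd 2"
    using assms(2) zdvd_imp_le by fastforce
  have "\<not> (p dvd x - y \<and> p dvd x + y)"
  proof
    assume "p dvd x - y \<and> p dvd x + y"
    then have "p dvd (x - y) + (x + y)" using dvd_add by blast
    then have "p dvd 2 * x" by simp
    then have "p dvd x\<^sup>2"
      using assms(1) not2 by (simp add: prime_dvd_mult_iff prime_dvd_power_iff)
    moreover have "p dvd x\<^sup>2 - 2"
      using assms(3) by (metis dvd_mult_left power2_eq_square)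
    ultimately have "p dvd x\<^sup>2 - (x\<^sup>2 - 2)" by (rule dvd_diff)
    then show False using not2 by simp
  qed
  then have "coprime (p\<^sup>2) (x - y) \<or> coprime (p\<^sup>2) (x + y)"
    using prime_imp_coprime[OF assms(1)] by auto
  then show ?thesis
    using dvd by (auto simp: coprime_dvd_mult_left_iff coprime_dvd_mult_right_iff)
qed

text \<open>With \<open>u = r * M^2\<close>, the unscaled triangle has area
  \<open>u * (u^2 + 2 * e * u - 1)\<close>; scaling its sides by \<open>1/M\<close> leaves this
  integer.\<close>

definition twist_value :: "int \<Rightarrow> int \<Rightarrow> int \<Rightarrow> int" where
  "twist_value e M r = r * ((r * M\<^sup>2)\<^sup>2 + 2 * e * (r * M\<^sup>2) - 1)"

lemma twist_value_alt:
  assumes "e \<in> {1, -1}"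
  shows "twist_value e M r = r * ((r * M\<^sup>2 + e)\<^sup>2 - 2)"
  using assms by (auto simp: twist_value_def algebra_simps power2_eq_square)

text \<open>The quadratic factor is -1 modulo \<open>r\<close>, so the two factors are coprime and
  \<open>p^2\<close> cannot split between them.\<close>

lemma prime_square_dvd_twist_value:
  assumes "e \<in> {1, -1}" and "prime p" and "p\<^sup>2 dvd twist_value e M r"
  shows "p\<^sup>2 dvd r \<or> p\<^sup>2 dvd (r * M\<^sup>2 + e)\<^sup>2 - 2"
proof -
  let ?Q = "(r * M\<^sup>2 + e)\<^sup>2 - 2"
  have "?Q = r * (r * M ^ 4 + 2 * e * M\<^sup>2) - 1"
    using assms(1) by (auto simp: algebra_simps power2_eq_square power4_eq_xxxx)
  then have "\<not> (p dvd r \<and> p dvd ?Q)"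
    using assms(2) by (metis dvd_mult2 dvd_diff_right_iff not_prime_unit)
  then have "coprime (p\<^sup>2) r \<or> coprime (p\<^sup>2) ?Q"
    using prime_imp_coprime[OF assms(2)] by auto
  then show ?thesis
    using assms(3) unfolding twist_value_alt[OF assms(1)]
    by (auto simp: coprime_dvd_mult_left_iff coprime_dvd_mult_right_iff)
qed

text \<open>As \<open>p\<close> is coprime to \<open>M\<close>, both \<open>r0 + M * k\<close> and
  \<open>x k\<close>, of slope \<open>M^3\<close>, determine \<open>k\<close> modulo
  \<open>p^2\<close>. The linear factor then excludes at most one class, and the square roots of 2
  at most two.\<close>

lemma card_prime_square_dvd_twist_value:
  fixes p K :: nat and M r0 e :: int
  assumes e: "e \<in> {1, -1}" and p: "prime p" "2 < p" and cop: "coprime (int p) M"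
  shows "card {k \<in> {..<K}. (int p)\<^sup>2 dvd twist_value e M (r0 + M * int k)} \<le> 3 * (K div p\<^sup>2 + 1)"
proof -
  define x where "x k = (r0 + M * int k) * M\<^sup>2 + e" for k
  define A where "A = {k \<in> {..<K}. (int p)\<^sup>2 dvd r0 + M * int k}"
  define B where "B = {k \<in> {..<K}. (int p)\<^sup>2 dvd (x k)\<^sup>2 - 2}"
  have cong: "[j = k] (mod p\<^sup>2)" if "(int p)\<^sup>2 dvd M ^ i * (int j - int k)" for i j k
  proof -
    have "coprime ((int p)\<^sup>2) (M ^ i)" using cop by simp
    then have "(int p)\<^sup>2 dvd int j - int k"
      using that by (simp add: coprime_dvd_mult_right_iff)
    then show ?thesis
      by (simp add: cong_iff_dvd_diff flip: cong_int_iff)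
  qed
  have x_diff: "x j - x k = M ^ 3 * (int j - int k)" for j k
    by (simp add: x_def algebra_simps power2_eq_square power3_eq_cube)
  have cong_x: "[j = k] (mod p\<^sup>2)" if "(int p)\<^sup>2 dvd x j - x k" for j k
    using cong that unfolding x_diff .
  have p2: "0 < p\<^sup>2" using p by simp
  have A: "card A \<le> K div p\<^sup>2 + 1"
  proof (rule card_pairwise_cong_le[OF _ p2])
    fix j k assume "j \<in> A" "k \<in> A"
    then have "(int p)\<^sup>2 dvd (r0 + M * int j) - (r0 + M * int k)"
      unfolding A_def by - (rule dvd_diff, auto)
    then show "[j = k] (mod p\<^sup>2)"
      using cong[of 1] by (simp add: algebra_simps)
  qed (auto simp: A_def)
  have B: "card B \<le> 2 * (K div p\<^sup>2 + 1)"
  proof (cases "B = {}")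
    case False
    then obtain j where j: "j \<in> B" by auto
    \<comment> \<open>Relative to one root \<open>x j\<close>, every other root is
      \<open>x j\<close> or \<open>- x j\<close>; each sign gives a single class of indices.\<close>
    define C where "C = {k \<in> B. (int p)\<^sup>2 dvd x k - x j}"
    define D where "D = {k \<in> B. (int p)\<^sup>2 dvd x k + x j}"
    have "B \<subseteq> C \<union> D"
      using j p prime_square_dvd_diff_or_sum[of "int p"] by (auto simp: B_def C_def D_def)
    then have "card B \<le> card (C \<union> D)"
      by (intro card_mono) (auto simp: B_def C_def D_def)
    also have "\<dots> \<le> card C + card D" by (rule card_Un_le)
    also have "card C \<le> K div p\<^sup>2 + 1"
    proof (rule card_pairwise_cong_le[OF _ p2])
      fix k l assume "k \<in> C" "l \<in> C"
      then have "(int p)\<^sup>2 dvd (x k - x j) - (x l - x j)"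
        unfolding C_def by - (rule dvd_diff, auto)
      then show "[k = l] (mod p\<^sup>2)" by (intro cong_x) simp
    qed (auto simp: B_def C_def)
    also have "card D \<le> K div p\<^sup>2 + 1"
    proof (rule card_pairwise_cong_le[OF _ p2])
      fix k l assume "k \<in> D" "l \<in> D"
      then have "(int p)\<^sup>2 dvd (x k + x j) - (x l + x j)"
        unfolding D_def by - (rule dvd_diff, auto)
      then show "[k = l] (mod p\<^sup>2)" by (intro cong_x) simp
    qed (auto simp: B_def D_def)
    finally show ?thesis by simp
  qed simp
  have "{k \<in> {..<K}. (int p)\<^sup>2 dvd twist_value e M (r0 + M * int k)} \<subseteq> A \<union> B"
    using prime_square_dvd_twist_value[OF e, of "int p"] p by (auto simp: A_def B_def x_def)
  then have "card {k \<in> {..<K}. (int p)\<^sup>2 dvd twist_value e M (r0 + M * int k)} \<le> card (A \<union> B)"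
    by (intro card_mono) (auto simp: A_def B_def)
  also have "\<dots> \<le> card A + card B" by (rule card_Un_le)
  also have "\<dots> \<le> (K div p\<^sup>2 + 1) + 2 * (K div p\<^sup>2 + 1)" by (intro add_mono A B)
  finally show ?thesis by simp
qed

section \<open>Residue classes avoiding the squares of small primes\<close>

lemma coprime_in_residue_class:
  fixes a m L :: int
  assumes "coprime a m" and "L \<noteq> 0"
  shows "\<exists>t. coprime (a + m * t) L"
proof -
  \<comment> \<open>With this \<open>t\<close>, each prime of \<open>L\<close> divides exactly one
    of \<open>a\<close> and \<open>m * t\<close>: it divides \<open>t\<close> iff it does not divide
    \<open>a\<close>, and if it divides \<open>a\<close> it cannot divide \<open>m\<close>.\<close>
  define t where "t = \<Prod>{p \<in> prime_factors L. \<not> p dvd a}"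
  have "coprime (a + m * t) L"
  proof (rule ccontr)
    assume "\<not> coprime (a + m * t) L"
    then have "\<not> is_unit (gcd (a + m * t) L)"
      by (simp add: coprime_iff_gcd_eq_1)
    moreover have "gcd (a + m * t) L \<noteq> 0"
      using assms(2) by simp
    ultimately obtain p where p: "prime p" "p dvd gcd (a + m * t) L"
      using prime_divisor_exists by blast
    then have dvd: "p dvd a + m * t" and pL: "p \<in> prime_factors L"
      using assms(2) by (auto simp: in_prime_factors_iff)
    have t: "p dvd t \<longleftrightarrow> \<not> p dvd a"
    proof
      assume "p dvd t"
      then obtain q where "q \<in> prime_factors L" "\<not> q dvd a" "p dvd q"
        using p(1) by (auto simp: t_def prime_dvd_prod_iff)
      then show "\<not> p dvd a"
        using p(1) primes_dvd_imp_eq by auto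
    next
      assume "\<not> p dvd a"
      then show "p dvd t"
        using pL unfolding t_def by (intro dvd_prodI) auto
    qed
    show False
    proof (cases "p dvd a")
      case True
      then have "p dvd m * t" using dvd by (simp add: dvd_add_right_iff)
      then have "p dvd m" using t True p(1) by (simp add: prime_dvd_mult_iff)
      then show False
        using assms(1) True p(1) by (meson coprime_common_divisor not_prime_unit)
    next
      case False
      then have "p dvd m * t" using t by simp
      then show False using dvd False by (simp add: dvd_add_left_iff)
    qed
  qed
  then show ?thesis ..
qed

text \<open>After removing the gcd \<open>g\<close>, the cofactor of \<open>a\<close> can be moved
  within its class to be coprime to \<open>L\<close>. Any \<open>p^2\<close> dividing the result
  must then divide \<open>g\<close>, which is squarefree.\<close>

lemma residue_class_avoiding_small_squares:
  fixes a m L :: int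
  assumes "m \<noteq> 0" and "squarefree (gcd a m)" and "L \<noteq> 0"
  shows "\<exists>r. [r = a] (mod m) \<and> (\<forall>p. prime p \<longrightarrow> p dvd L \<longrightarrow> \<not> p\<^sup>2 dvd r)"
proof -
  define g where "g = gcd a m"
  obtain a' m' where eq: "a = g * a'" "m = g * m'" and "coprime a' m'"
    using assms(1) unfolding g_def by (metis dvd_mult_div_cancel gcd_dvd1 gcd_dvd2 div_gcd_coprime)
  then obtain t where t: "coprime (a' + m' * t) L"
    using coprime_in_residue_class assms(3) by blast
  have "\<not> p\<^sup>2 dvd g * (a' + m' * t)" if p: "prime p" "p dvd L" for p
  proof
    assume dvd: "p\<^sup>2 dvd g * (a' + m' * t)"
    have "\<not> p dvd a' + m' * t"
      using t p by (meson coprime_common_divisor not_prime_unit)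
    then have "coprime (p\<^sup>2) (a' + m' * t)"
      using prime_imp_coprime[OF p(1)] by simp
    then have "p\<^sup>2 dvd g"
      using dvd by (simp add: coprime_dvd_mult_left_iff)
    then show False
      using assms(2) p(1) squarefreeD not_prime_unit unfolding g_def by blast
  qed
  moreover have "[g * (a' + m' * t) = a] (mod m)"
    by (simp add: eq algebra_simps cong_iff_dvd_diff)
  ultimately show ?thesis by blast
qed

section \<open>Triangles\<close>

lemma theta_congruent_twist_value:
  assumes e: "e \<in> {1, -1}" and \<gamma>: "cos \<gamma> = real_of_int e / sqrt 2" "sin \<gamma> = 1 / sqrt 2"
    and "1 < M" and "1 \<le> r"
  shows "theta_congruent \<gamma> (nat (twist_value e M r))" and "0 < twist_value e M r"
proof -
  define u where "u = r * M\<^sup>2"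
  define q where "q = u\<^sup>2 + 2 * e * u - 1"
  \<comment> \<open>The bound \<open>4 <= u\<close> keeps \<open>q\<close> positive for
    \<open>e = -1\<close> as well.\<close>
  have "1 * 2\<^sup>2 \<le> r * M\<^sup>2"
    using assms by (intro mult_mono power_mono) auto
  then have u: "4 \<le> u" by (simp add: u_def)
  have "q \<ge> u * (u - 2) - 1"
    using e u by (auto simp: q_def algebra_simps power2_eq_square)
  moreover have "u * (u - 2) \<ge> 4 * 2"
    using u by (intro mult_mono) auto
  ultimately have q: "0 < q" by linarith
  have eq: "twist_value e M r = r * q"
    by (simp add: twist_value_def u_def q_def)
  show pos: "0 < twist_value e M r"
    using q assms by (simp add: eq)
  \<comment> \<open>Solving \<open>a - e * b = u^2 - 1\<close>, \<open>b = 2 * u\<close>,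
    \<open>c = u^2 + 1\<close> and dividing by \<open>M\<close>; in \<open>b\<close> this leaves
    \<open>2 * r * M\<close>.\<close>
  define a b c :: rat where "a = of_int q / of_int M" and "b = of_int (2 * r * M)"
    and "c = of_int (u\<^sup>2 + 1) / of_int M"
  have 1: "a > 0" "b > 0" "c > 0"
    using assms q by (auto simp: a_def b_def c_def add_nonneg_pos)
  have a: "real_of_rat a = q / M" and b: "real_of_rat b = 2 * u / M"
    and c: "real_of_rat c = (u\<^sup>2 + 1) / M"
    using \<open>1 < M\<close> by (simp_all add: a_def b_def c_def u_def of_rat_divide of_rat_mult of_rat_add
      of_rat_power power2_eq_square)
  have id: "((u::real)\<^sup>2 + 1)\<^sup>2 = (u\<^sup>2 + 2 * e * u - 1)\<^sup>2 + 2 * (2 * u)\<^sup>2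
      - 2 * (u\<^sup>2 + 2 * e * u - 1) * (2 * u) * e" for u
    using e by (auto simp: algebra_simps power2_eq_square)
  have "(real_of_rat c)\<^sup>2 = (real_of_rat a)\<^sup>2 + 2 * (real_of_rat b)\<^sup>2 - 2 * real_of_rat a * real_of_rat b * e"
    unfolding a b c using id[of u] \<open>1 < M\<close> by (simp add: q_def field_simps power2_eq_square)
  then have 2: "(real_of_rat c)\<^sup>2 = (real_of_rat a)\<^sup>2 + (real_of_rat b * sqrt 2)\<^sup>2
            - 2 * real_of_rat a * (real_of_rat b * sqrt 2) * cos \<gamma>"
    by (simp add: \<gamma> power_mult_distrib mult.assoc)
  have "real (nat (twist_value e M r)) = 1/2 * real_of_rat a * real_of_rat b"
    using pos \<open>1 < M\<close> unfolding a b eq by (simp add: u_def power2_eq_square)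
  then have 3: "real (nat (twist_value e M r)) = 1/2 * real_of_rat a * (real_of_rat b * sqrt 2) * sin \<gamma>"
    by (simp add: \<gamma>)
  show "theta_congruent \<gamma> (nat (twist_value e M r))"
    unfolding theta_congruent_def using pos 1 2 3 by auto
qed

section \<open>The sieve\<close>

text \<open>If only finitely many indices \<open>G\<close> were good, they and the sets
  \<open>bad p\<close> would cover \<open>{..<K}\<close>. The terms \<open>3 * K / p^2\<close> sum
  to at most \<open>K/4\<close>, the constants 3 to at most \<open>3 * 16 ^ q + K/4\<close>, leaving
  half of \<open>K\<close> for a bounded quantity.\<close>

lemma infinite_squarefree_twist_values:
  fixes e M r0 :: int and z :: nat
  assumes e: "e \<in> {1, -1}" and M: "1 < M" and r0: "1 \<le> r0" "r0 \<le> M" and z: "12 \<le> z"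
    and small: "\<And>p. prime p \<Longrightarrow> p \<le> z \<Longrightarrow> (int p)\<^sup>2 dvd M \<and> \<not> (int p)\<^sup>2 dvd r0"
    and large: "\<And>p. prime p \<Longrightarrow> z < p \<Longrightarrow> coprime (int p) M"
  shows "infinite {k. squarefree (twist_value e M (r0 + M * int k))}"
proof
  define r where "r k = r0 + M * int k" for k
  define G where "G = {k. squarefree (twist_value e M (r k))}"
  assume "finite {k. squarefree (twist_value e M (r0 + M * int k))}"
  then have G: "finite G" by (simp add: G_def r_def)
  define \<mu> where "\<mu> = nat M ^ 3"
  have \<mu>: "0 < \<mu>" "int \<mu> = M ^ 3" using M by (auto simp: \<mu>_def)
  \<comment> \<open>Chosen so that \<open>prime_count_le\<close> at \<open>Y = \<mu> * K\<close>
    gives \<open>16 ^ q + K/12\<close>.\<close>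
  define q where "q = 12 * \<mu>"
  \<comment> \<open>Half of \<open>K\<close> exceeds \<open>card G + 3 * 16 ^ q\<close> by
    1.\<close>
  define K where "K = 2 * (card G + 3 * 16 ^ q) + 2"
  define Y where "Y = \<mu> * K"
  define P where "P = {p::nat. prime p \<and> z < p \<and> p \<le> Y}"
  define bad where "bad p = {k \<in> {..<K}. (int p)\<^sup>2 dvd twist_value e M (r k)}" for p
  have finP: "finite P" by (auto simp: P_def)
  have cover: "{..<K} \<subseteq> G \<union> (\<Union>p\<in>P. bad p)"
  proof
    fix k assume k: "k \<in> {..<K}"
    have rk: "1 \<le> r k" using r0 M by (auto simp: r_def intro: add_increasing2)
    have "r k \<le> M * (int k + 1)" using r0 by (simp add: r_def algebra_simps)
    also have "\<dots> \<le> M * int K" using k M by (intro mult_left_mono) auto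
    finally have rK: "r k \<le> M * int K" .
    then have "r k * M\<^sup>2 \<le> M * int K * M\<^sup>2" by (intro mult_right_mono) auto
    then have rM: "r k * M\<^sup>2 \<le> int Y"
      using \<mu> by (simp add: Y_def power2_eq_square power3_eq_cube mult_ac)
    have M2: "4 \<le> M\<^sup>2" using power_mono[of 2 M 2] M by simp
    have rM4: "r k * 4 \<le> r k * M\<^sup>2" using M2 rk by (intro mult_left_mono) auto
    have e1: "-1 \<le> e" "e \<le> 1" using e by auto
    show "k \<in> G \<union> (\<Union>p\<in>P. bad p)"
    proof (rule ccontr)
      assume notin: "k \<notin> G \<union> (\<Union>p\<in>P. bad p)"
      have "r k * ((r k * M\<^sup>2 + e)\<^sup>2 - 2) > 0"
      proof -
        have "3 \<le> r k * M\<^sup>2 + e" using e1 rM4 rk by linarith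
        then have "3\<^sup>2 \<le> (r k * M\<^sup>2 + e)\<^sup>2" by (intro power_mono) auto
        then show ?thesis using rk by simp
      qed
      then have pos: "twist_value e M (r k) \<noteq> 0" "0 < (r k * M\<^sup>2 + e)\<^sup>2 - 2"
        using rk by (auto simp: twist_value_alt[OF e] zero_less_mult_iff)
      obtain p' where p': "prime p'" "p'\<^sup>2 dvd twist_value e M (r k)"
        using notin squarefree_factorial_semiring[OF pos(1)] by (auto simp: G_def)
      define p where "p = nat p'"
      have p: "prime p" "int p = p'"
        using iffD1[OF prime_int_nat_transfer p'(1)] by (simp_all add: p_def)
      have cases: "(int p)\<^sup>2 dvd r k \<or> (int p)\<^sup>2 dvd (r k * M\<^sup>2 + e)\<^sup>2 - 2"
        using prime_square_dvd_twist_value[OF e] p' p by blast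
      show False
      proof (cases "p \<le> z")
        case True
        \<comment> \<open>Modulo \<open>p^2\<close>, which divides \<open>M\<close>,
          \<open>r k\<close> is \<open>r0\<close> and the quadratic factor is -1; neither
          vanishes.\<close>
        then have pM: "(int p)\<^sup>2 dvd M" and pr: "\<not> (int p)\<^sup>2 dvd r0" using small p by auto
        from pM pr have "\<not> (int p)\<^sup>2 dvd r k"
          by (simp add: r_def dvd_add_left_iff)
        with cases have "(int p)\<^sup>2 dvd (r k * M\<^sup>2 + e)\<^sup>2 - 2" by simp
        moreover have "(r k * M\<^sup>2 + e)\<^sup>2 - 2 = M * (r k * M * (r k * M\<^sup>2 + 2 * e)) - 1"
          using e by (auto simp: algebra_simps power2_eq_square)
        ultimately have "(int p)\<^sup>2 dvd 1"
          using pM by (metis dvd_mult2 dvd_diff_right_iff)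
        then have "p' dvd 1" using p(2) by (metis dvd_mult_left power2_eq_square)
        then show False using p'(1) not_prime_unit by blast
      next
        case False
        \<comment> \<open>Splitting the value into factors keeps this bound linear in
          \<open>K\<close>. In the quadratic case \<open>p^2\<close> is below a perfect square, so
          \<open>p < r k * M^2 + e\<close>; the strict inequality absorbs
          \<open>e = 1\<close>.\<close>
        have "int p \<le> int Y"
          using cases
        proof
          assume "(int p)\<^sup>2 dvd r k"
          then have "(int p)\<^sup>2 \<le> r k" using rk by (intro zdvd_imp_le) auto
          moreover have "int p \<le> (int p)\<^sup>2" using prime_gt_0_nat[OF p(1)] by (intro self_le_power) auto
          ultimately show ?thesis using rM rM4 rk by linarith
        next
          assume "(int p)\<^sup>2 dvd (r k * M\<^sup>2 + e)\<^sup>2 - 2"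
          then have "(int p)\<^sup>2 \<le> (r k * M\<^sup>2 + e)\<^sup>2 - 2" using pos(2) by (intro zdvd_imp_le) auto
          then have "(int p)\<^sup>2 < (r k * M\<^sup>2 + e)\<^sup>2" by simp
          moreover have "0 \<le> r k * M\<^sup>2 + e" using e1 rM4 rk by linarith
          ultimately have "int p < r k * M\<^sup>2 + e" by (rule power_less_imp_less_base)
          then show ?thesis using e1 rM by linarith
        qed
        then have "p \<in> P" using False p by (simp add: P_def)
        moreover have "k \<in> bad p" using k p' p by (simp add: bad_def)
        ultimately show False using notin by blast
      qed
    qed
  qed
  have bad: "real (card (bad p)) \<le> 3 * real K * (1 / (real p)\<^sup>2) + 3" if "p \<in> P" for p
  proof -
    have "card (bad p) \<le> 3 * (K div p\<^sup>2 + 1)"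
      unfolding bad_def r_def
      by (rule card_prime_square_dvd_twist_value[OF e]) (use that z large in \<open>auto simp: P_def\<close>)
    then have "real (card (bad p)) \<le> real (3 * (K div p\<^sup>2 + 1))" by (simp only: of_nat_le_iff)
    also have "\<dots> = 3 * real (K div p\<^sup>2) + 3" by simp
    also have "real (K div p\<^sup>2) \<le> real K / real (p\<^sup>2)" by (rule of_nat_div_le_of_nat)
    finally show ?thesis by simp
  qed
  have "K \<le> card (G \<union> (\<Union>p\<in>P. bad p))"
    using card_mono[OF _ cover] G finP by (simp add: bad_def)
  also have "\<dots> \<le> card G + card (\<Union>p\<in>P. bad p)" by (rule card_Un_le)
  also have "\<dots> \<le> card G + (\<Sum>p\<in>P. card (bad p))"
    using card_UN_le[OF finP] by simp
  finally have "real K \<le> real (card G) + (\<Sum>p\<in>P. real (card (bad p)))"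
    by (simp flip: of_nat_sum of_nat_add)
  also have "(\<Sum>p\<in>P. real (card (bad p))) \<le> (\<Sum>p\<in>P. 3 * real K * (1 / (real p)\<^sup>2) + 3)"
    by (intro sum_mono bad)
  also have "\<dots> = 3 * real K * (\<Sum>p\<in>P. 1 / (real p)\<^sup>2) + 3 * real (card P)"
    by (simp add: sum.distrib sum_distrib_left)
  also have "(\<Sum>p\<in>P. 1 / (real p)\<^sup>2) \<le> 1 / 12"
  proof (cases "z \<le> Y")
    case True
    have "(\<Sum>p\<in>P. 1 / (real p)\<^sup>2) \<le> (\<Sum>p\<in>{z<..Y}. 1 / (real p)\<^sup>2)"
      by (intro sum_mono2) (auto simp: P_def)
    also have "\<dots> \<le> 1 / real z - 1 / real Y"
      using z True by (intro sum_inverse_squares_le) auto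
    also have "\<dots> \<le> 1 / real z" by simp
    also have "\<dots> \<le> 1 / 12" using z by (intro divide_left_mono) auto
    finally show ?thesis .
  next
    case False
    then have "P = {}" by (auto simp: P_def)
    then show ?thesis by simp
  qed
  also have "real (card P) \<le> 16 ^ q + real K / 12"
  proof -
    have "q * card P \<le> q * card {p::nat. prime p \<and> p \<le> Y}"
      by (intro mult_le_mono2 card_mono) (auto simp: P_def)
    also have "\<dots> \<le> q * 16 ^ q + Y" by (rule prime_count_le)
    finally have "\<mu> * (12 * card P) \<le> \<mu> * (12 * 16 ^ q + K)"
      by (simp add: q_def Y_def algebra_simps)
    then have "12 * card P \<le> 12 * 16 ^ q + K" using \<mu>(1) by simp
    then have "real (12 * card P) \<le> real (12 * 16 ^ q + K)" by (simp only: of_nat_le_iff)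
    then show ?thesis by simp
  qed
  finally have "real K \<le> real (card G) + 3 * 16 ^ q + real K / 2"
    by (simp add: mult_left_mono)
  then show False by (simp add: K_def)
qed

section \<open>Choice of the modulus and the residue class, and conclusion\<close>

theorem theorem5p4:
  fixes m a :: int and \<gamma> :: real
  assumes "m > 1" and "squarefree (gcd a m)" and "\<gamma> \<in> {pi/4, 3*pi/4}"
  shows "infinite {n :: nat. [int n = a] (mod m) \<and> squarefree n \<and> theta_congruent \<gamma> n}"
proof -
  obtain e :: int where e: "e \<in> {1, -1}" and \<gamma>: "cos \<gamma> = real_of_int e / sqrt 2" "sin \<gamma> = 1 / sqrt 2"
  proof -
    have "sqrt 2 / 2 = 1 / sqrt 2"
      by (simp add: field_simps)
    moreover have "3 * pi / 4 = pi - pi / 4" by simp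
    ultimately have "cos (pi / 4) = 1 / sqrt 2" "sin (pi / 4) = 1 / sqrt 2"
      "cos (3 * pi / 4) = - (1 / sqrt 2)" "sin (3 * pi / 4) = 1 / sqrt 2"
      by (simp_all only: cos_45 sin_45 cos_pi_minus sin_pi_minus)
    then show thesis
      using assms(3) that[of 1] that[of "-1"] by (elim insertE emptyE) simp_all
  qed
  \<comment> \<open>Exceeding \<open>m\<close> keeps primes above \<open>z\<close> from dividing
    \<open>m\<close>; 12 serves the tail of the inverse squares.\<close>
  define z where "z = nat m + 12"
  define L :: int where "L = fact z"
  \<comment> \<open>The factor \<open>m\<close> controls the residue, \<open>L^2\<close> supplies
    every \<open>p^2\<close> with \<open>p <= z\<close>, and no prime above \<open>z\<close>
    enters.\<close>
  define M where "M = m * L\<^sup>2"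
  have "L \<noteq> 0" "L > 0" by (simp_all add: L_def)
  then have M: "1 < M" and "m dvd M"
    using assms(1) by (auto simp: M_def less_1_mult' intro: less_le_trans[of 1 "m * 1"])
  have dvd_L: "int p dvd L" if "prime p" "p \<le> z" for p
    using that unfolding L_def by (metis dvd_fact of_nat_dvd_iff of_nat_fact prime_ge_1_nat)
  \<comment> \<open>The sign is reversed because the area is congruent to \<open>- r\<close> modulo
    \<open>M\<close>.\<close>
  have "squarefree (gcd (- a) m)" using assms(2) by simp
  then obtain s where s: "[s = - a] (mod m)" "\<And>p. prime p \<Longrightarrow> p dvd L \<Longrightarrow> \<not> p\<^sup>2 dvd s"
    using residue_class_avoiding_small_squares[of m "- a" L] assms(1) \<open>L \<noteq> 0\<close> by auto
  define r0 where "r0 = s mod M"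
  have small: "(int p)\<^sup>2 dvd M \<and> \<not> (int p)\<^sup>2 dvd r0" if "prime p" "p \<le> z" for p
  proof -
    have "(int p)\<^sup>2 dvd M"
      unfolding M_def using dvd_L[OF that] by (intro dvd_mult dvd_power_same)
    then show ?thesis
      using s(2)[of "int p"] that dvd_L[OF that] by (simp add: r0_def dvd_mod_iff)
  qed
  \<comment> \<open>The prime 2 is small, so 4 does not divide \<open>r0\<close>.\<close>
  have "r0 \<noteq> 0" using small[of 2] by (auto simp: z_def)
  moreover have "0 \<le> r0" "r0 < M" using M by (auto simp: r0_def)
  ultimately have r0: "1 \<le> r0" "r0 \<le> M" by auto
  have large: "coprime (int p) M" if p: "prime p" "z < p" for p
  proof -
    have "\<not> int p dvd m"
      using p assms(1) zdvd_imp_le[of "int p" m] by (auto simp: z_def)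
    moreover have "\<not> int p dvd L"
      using p prime_dvd_fact_iff[of p z] unfolding L_def by (metis not_less of_nat_dvd_iff of_nat_fact)
    ultimately show ?thesis
      using p by (intro prime_imp_coprime) (auto simp: M_def prime_dvd_mult_iff prime_dvd_power_iff)
  qed
  define r where "r k = r0 + M * int k" for k
  define n where "n k = nat (twist_value e M (r k))" for k
  have r_pos: "1 \<le> r k" for k using r0 M by (auto simp: r_def intro: add_increasing2)
  note n = theta_congruent_twist_value[OF e \<gamma> M r_pos]
  have "[twist_value e M (r k) = a] (mod m)" for k
  proof -
    have "m dvd twist_value e M (r k) + r k"
    proof -
      have "twist_value e M (r k) + r k = M * (r k * (r k * M * (r k * M\<^sup>2 + 2 * e)))"
        by (simp add: twist_value_def algebra_simps power2_eq_square)
      then show ?thesis using \<open>m dvd M\<close> by simp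
    qed
    moreover have "m dvd r k - s"
    proof -
      have "r k - s = M * (int k - s div M)"
        by (simp add: r_def r0_def right_diff_distrib flip: minus_mult_div_eq_mod)
      then show ?thesis using \<open>m dvd M\<close> by simp
    qed
    moreover have "m dvd s + a"
      using s(1) by (simp add: cong_iff_dvd_diff)
    ultimately have "m dvd (twist_value e M (r k) + r k) - (r k - s) - (s + a)"
      using dvd_diff by blast
    then show ?thesis by (simp add: cong_iff_dvd_diff)
  qed
  then have cong: "[int (n k) = a] (mod m)" for k
    using n(2)[of k] by (simp add: n_def)
  have sqf: "squarefree (n k)" if "squarefree (twist_value e M (r k))" for k
  proof (rule squarefreeI)
    fix x assume "x\<^sup>2 dvd n k"
    then have "int (x\<^sup>2) dvd int (n k)" by (simp only: of_nat_dvd_iff)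
    then have "(int x)\<^sup>2 dvd twist_value e M (r k)" using n(2)[of k] by (simp add: n_def)
    then show "x dvd 1" using squarefreeD[OF that] by fastforce
  qed
  \<comment> \<open>This growth makes the image of an infinite set of indices unbounded.\<close>
  have n_ge: "k \<le> n k" for k
  proof -
    have "r k \<le> twist_value e M (r k)"
      using n(2)[of k] by (intro zdvd_imp_le) (auto simp: twist_value_def)
    moreover have "1 * int k \<le> M * int k"
      using M by (intro mult_right_mono) auto
    ultimately show ?thesis
      using r0 by (simp add: n_def r_def)
  qed
  have "infinite {k. squarefree (twist_value e M (r k))}"
    unfolding r_def
    by (rule infinite_squarefree_twist_values[OF e M r0, of z]) (use small large in \<open>auto simp: z_def\<close>)
  then have "infinite (n ` {k. squarefree (twist_value e M (r k))})"
    using n_ge unfolding infinite_nat_iff_unbounded_le by (blast intro: order.trans)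
  moreover have "n ` {k. squarefree (twist_value e M (r k))}
      \<subseteq> {n. [int n = a] (mod m) \<and> squarefree n \<and> theta_congruent \<gamma> n}"
    using cong sqf n(1) by (auto simp: n_def)
  ultimately show ?thesis by (rule infinite_super[rotated])
qed

end
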